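(* Let $\mathsf F:X\to X^\star$ satisfy (F1) and (F2), let the forms $a(u;\cdot,\cdot)$ be uniformly coercive and bounded with constants $\alpha,\beta>0$, let the error estimators $\eta_N$ satisfy (A1) and (A2) with constants $C_{A1},C_{A2}\ge1$, and let $\lambda\in(0,C_\lambda^{-1})$, where $C_\lambda:=(1+\beta/\nu)\,C_{A1}$. Assume that for each $N\ge0$ the inner (while) loop of the adaptive ILG algorithm with parameter $\lambda$ terminates after finitely many steps, yielding an output $u_N\in X_N$ with $\eta_N(u_N)>0$. Suppose further that there are constants $0<q<1$ and $C_p>0$ such that $$\eta_{N+1}(u_{N+1}^\star)^2\le q\,\eta_N(u_N^\star)^2+C_p\|u_{N+1}^\star-u_N^\star\|_X^2\qquad\text{for all }N\ge0 .$$ Then $u_N\to u^\star$ in $X$ as $N\to\infty$, where $u^\star\in X$ is the unique solution of $\mathsf F(u)=0$.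
   Context: $X$ is a real Hilbert space with norm $\|\cdot\|_X$, dual $X^\star$ and duality pairing $\langle\cdot,\cdot\rangle$ on $X^\star\times X$. Conditions on $\mathsf F:X\to X^\star$: (F1) there is $L_{\mathsf F}>0$ with $|\langle \mathsf F(u)-\mathsf F(v),w\rangle|\le L_{\mathsf F}\|u-v\|_X\|w\|_X$ for all $u,v,w\in X$; (F2) there is $\nu>0$ with $\nu\|u-v\|_X^2\le\langle \mathsf F(u)-\mathsf F(v),u-v\rangle$ for all $u,v\in X$. Under (F1)–(F2), $\mathsf F(u)=0$ has a unique solution $u^\star\in X$. For each $v\in X$, $\mathsf A[v]:X\to X^\star$ is a given linear invertible operator; $a(u;v,w):=\langle \mathsf A[u]v,w\rangle$ and $f(u):=\mathsf A[u]u-\mathsf F(u)\in X^\star$. Uniform coercivity and boundedness mean: there are $\alpha,\beta>0$, independent of $u\in X$, with $a(u;v,v)\ge\alpha\|v\|_X^2$ and $a(u;v,w)\le\beta\|v\|_X\|w\|_X$ for all $u,v,w\in X$. $X_0\subset X_1\subset X_2\subset\cdots\subset X$ are finite dimensional subspaces. $u_N^\star\in X_N$ is the unique solution of $\langle \mathsf F(u_N^\star),v\rangle=0$ for all $v\in X_N$. For each $N\ge0$, $\eta_N:X_N\to[0,\infty)$ is a function (error estimator). With constants $C_{A1},C_{A2}\ge1$ independent of $N$: (A1) $|\eta_N(u)-\eta_N(v)|\le C_{A1}\|u-v\|_X$ for all $u,v\in X_N$; (A2) $\|u^\star-u_N^\star\|_X\le C_{A2}\,\eta_N(u_N^\star)$.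 Adaptive ILG algorithm with parameter $\lambda>0$: start with $X_0$ and an arbitrary $u_0^0\in X_0$. For $N=0,1,2,\dots$: starting from $u_N^0\in X_N$, compute for $n=0,1,2,\dots$ the solution $u_N^{n+1}\in X_N$ of $a(u_N^n;u_N^{n+1},v)=\langle f(u_N^n),v\rangle$ for all $v\in X_N$, and stop this inner (while) loop at the first index $n\ge1$ for which $\|u_N^n-u_N^{n-1}\|_X\le\lambda\,\eta_N(u_N^n)$; set $u_N:=u_N^n$ for this index, enrich $X_N$ to $X_{N+1}\supset X_N$ (based on $\eta_N(u_N)$), and set $u_{N+1}^0:=u_N$. The outer loop is run for all $N\ge0$. *)

theory Defs
  imports "HOL-Analysis.Analysis"
begin

text \<open>
  The Hilbert space is a type of sort \<open>{real_inner, complete_space}\<close>, its dual is the type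
  \<open>'a \<Rightarrow>\<^sub>L real\<close> of bounded linear functionals, and the duality pairing of \<open>\<phi>\<close> with \<open>v\<close> is
  the application \<open>blinfun_apply \<phi> v\<close>, written \<open>\<phi> v\<close> through the coercion.
\<close>

definition exact_solution :: "('a::real_normed_vector \<Rightarrow> 'a \<Rightarrow>\<^sub>L real) \<Rightarrow> 'a"
  where "exact_solution F = (THE u. F u = 0)"

definition galerkin_solution :: "('a::real_normed_vector \<Rightarrow> 'a \<Rightarrow>\<^sub>L real) \<Rightarrow> 'a set \<Rightarrow> 'a"
  where "galerkin_solution F V = (THE u. u \<in> V \<and> (\<forall>v\<in>V. F u v = 0))"

definition ilg_rhs ::
  "('a::real_normed_vector \<Rightarrow> 'a \<Rightarrow> 'a \<Rightarrow>\<^sub>L real) \<Rightarrow> ('a \<Rightarrow> 'a \<Rightarrow>\<^sub>L real) \<Rightarrow> 'a \<Rightarrow> 'a \<Rightarrow>\<^sub>L real"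
  where "ilg_rhs A F u = A u u - F u"

definition ilg_step ::
  "('a::real_normed_vector \<Rightarrow> 'a \<Rightarrow> 'a \<Rightarrow>\<^sub>L real) \<Rightarrow> ('a \<Rightarrow> 'a \<Rightarrow>\<^sub>L real) \<Rightarrow> 'a set \<Rightarrow> 'a \<Rightarrow> 'a \<Rightarrow> bool"
  where "ilg_step A F V u u' \<longleftrightarrow> u' \<in> V \<and> (\<forall>v\<in>V. A u u' v = ilg_rhs A F u v)"

definition ilg_stop ::
  "real \<Rightarrow> ('a::real_normed_vector \<Rightarrow> real) \<Rightarrow> (nat \<Rightarrow> 'a) \<Rightarrow> nat \<Rightarrow> bool"
  where "ilg_stop lam \<eta> w n \<longleftrightarrow> n \<ge> 1 \<and> norm (w n - w (n - 1)) \<le> lam * \<eta> (w n)"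

text \<open>Only meaningful if \<open>ilg_stop\<close> holds for some index, i.e. if the inner loop terminates.\<close>

definition ilg_output ::
  "real \<Rightarrow> ('a::real_normed_vector \<Rightarrow> real) \<Rightarrow> (nat \<Rightarrow> 'a) \<Rightarrow> 'a"
  where "ilg_output lam \<eta> w = w (LEAST n. ilg_stop lam \<eta> w n)"

text \<open>
  \<open>adaptive_ilg lam A F V \<eta> u\<close>: the array \<open>u N n\<close> holds the iterates of a run of the adaptive
  algorithm on the subspaces \<open>V N\<close>. The step from \<open>n\<close> to \<open>Suc n\<close> is performed
  as long as no index up to \<open>n\<close> satisfies the stopping criterion; the values \<open>u N n\<close> beyond
  the stopping index are irrelevant and left unconstrained.
\<close>

definition adaptive_ilg ::
  "real \<Rightarrow> ('a::real_normed_vector \<Rightarrow> 'a \<Rightarrow> 'a \<Rightarrow>\<^sub>L real) \<Rightarrow> ('a \<Rightarrow> 'a \<Rightarrow>\<^sub>L real) \<Rightarrow>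
   (nat \<Rightarrow> 'a set) \<Rightarrow> (nat \<Rightarrow> 'a \<Rightarrow> real) \<Rightarrow> (nat \<Rightarrow> nat \<Rightarrow> 'a) \<Rightarrow> bool"
  where "adaptive_ilg lam A F V \<eta> u \<longleftrightarrow>
    u 0 0 \<in> V 0 \<and>
    (\<forall>N n. (\<forall>m\<le>n. \<not> ilg_stop lam (\<eta> N) (u N) m) \<longrightarrow> ilg_step A F (V N) (u N n) (u N (Suc n))) \<and>
    (\<forall>N. u (Suc N) 0 = ilg_output lam (\<eta> N) (u N))"

end

theory Submission
  imports Defs
begin

text \<open>
  By Banach's fixed point theorem (Zarantonello iteration), \<open>F\<close> restricted to any closed subspace
  has a unique zero in the Galerkin sense.  The Galerkin solutions on \<open>V N\<close> therefore converge,
  by Cea's lemma, to the Galerkin solution on the closure of the union of all \<open>V N\<close>, so that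
  their increments vanish.  The reduction property then forces the estimators at the Galerkin
  solutions to zero, and reliability (A2) identifies the limit as the exact solution.
  Finally, the stopping criterion bounds the distance of the output to the Galerkin
  solution by the estimator at the Galerkin solution.
\<close>

section \<open>Closed subspaces of Hilbert spaces\<close>

text \<open>Over an orthogonal spanning set \<open>C\<close>, the Fourier sum \<open>P\<close> is
  the orthogonal projection onto the span. It is continuous, so the span, being its set of fixed
  points, is closed.\<close>

lemma closed_span_finite_real_inner:
  fixes B :: "'a::real_inner set"
  assumes "finite B"
  shows "closed (span B)"
proof -
  obtain C where C: "finite C" "span C = span B" "pairwise orthogonal C"
    using basis_orthogonal[OF assms] by blast
  define P where "P x = (\<Sum>c\<in>C. (inner x c / inner c c) *\<^sub>R c)" for x
  have P_span: "P x \<in> span C" for x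
    unfolding P_def by (intro span_sum span_scale span_base)
  have P_lin: "linear P"
    unfolding P_def
    by (intro linearI)
      (simp_all add: inner_add_left add_divide_distrib scaleR_add_left sum.distrib scaleR_sum_right)
  have P_id: "P x = x" if "x \<in> span C" for x
  proof (rule linear_eq_on[OF P_lin linear_ident that])
    fix d assume d: "d \<in> C"
    \<comment> \<open>\<open>C\<close> may contain 0. For \<open>c = d = 0\<close> the quotient is 0
      by the convention on division, and the term is still \<open>d\<close>.\<close>
    have "(inner d c / inner c c) *\<^sub>R c = (if c = d then d else 0)" if "c \<in> C" for c
      using C(3) d that by (auto simp: pairwise_def orthogonal_def)
    then show "P d = d"
      unfolding P_def using C(1) d by (simp add: sum.delta)
  qed
  have "span B = {x. P x = x}"
  proof (intro set_eqI iffI)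
    show "x \<in> {x. P x = x}" if "x \<in> span B" for x
      using that P_id C(2) by simp
    show "x \<in> span B" if "x \<in> {x. P x = x}" for x
      using that P_span[of x] C(2) by simp
  qed
  moreover have "closed {x. P x = x}"
    unfolding P_def divide_inverse
    by (intro closed_Collect_eq continuous_intros)
  ultimately show ?thesis by simp
qed

lemma subspace_closure:
  fixes S :: "'a::real_normed_vector set"
  assumes "subspace S"
  shows "subspace (closure S)"
proof (rule subspaceI)
  show "0 \<in> closure S"
    using closure_subset subspace_0[OF assms] by blast
next
  fix x y assume "x \<in> closure S" "y \<in> closure S"
  then obtain f g where "\<forall>n. f n \<in> S" "f \<longlonglongrightarrow> x" "\<forall>n. g n \<in> S" "g \<longlonglongrightarrow> y"
    by (auto simp: closure_sequential)
  then have "(\<forall>n. f n + g n \<in> S) \<and> (\<lambda>n. f n + g n) \<longlonglongrightarrow> x + y"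
    using assms by (auto intro: subspace_add tendsto_add)
  then show "x + y \<in> closure S"
    unfolding closure_sequential by (intro exI[of _ "\<lambda>n. f n + g n"])
next
  fix x and c :: real assume "x \<in> closure S"
  then obtain f where "\<forall>n. f n \<in> S" "f \<longlonglongrightarrow> x"
    by (auto simp: closure_sequential)
  then have "(\<forall>n. c *\<^sub>R f n \<in> S) \<and> (\<lambda>n. c *\<^sub>R f n) \<longlonglongrightarrow> c *\<^sub>R x"
    using assms by (auto intro: subspace_scale tendsto_intros)
  then show "c *\<^sub>R x \<in> closure S"
    unfolding closure_sequential by (intro exI[of _ "\<lambda>n. c *\<^sub>R f n"])
qed

lemma subspace_UN_incseq:
  fixes V :: "nat \<Rightarrow> 'a::real_vector set"
  assumes V: "\<And>n. subspace (V n)" and "incseq V"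
  shows "subspace (\<Union>n. V n)"
proof (rule subspaceI)
  show "0 \<in> (\<Union>n. V n)"
    using subspace_0[OF V] by blast
next
  fix x y assume "x \<in> (\<Union>n. V n)" "y \<in> (\<Union>n. V n)"
  then obtain m n where "x \<in> V m" "y \<in> V n" by blast
  then have "x \<in> V (max m n)" "y \<in> V (max m n)"
    using incseqD[OF \<open>incseq V\<close>] by (meson max.cobounded1 max.cobounded2 subsetD)+
  then show "x + y \<in> (\<Union>n. V n)"
    using subspace_add[OF V] by blast
next
  fix x and c :: real assume "x \<in> (\<Union>n. V n)"
  then show "c *\<^sub>R x \<in> (\<Union>n. V n)"
    using subspace_scale[OF V] by blast
qed

text \<open>The representer is the minimiser over \<open>V\<close> of the quadratic functional
  \<open>J\<close>, whose Euler equation is the claim. Working on a closed subspace rather than the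
  whole space lets the result serve every Galerkin problem directly.\<close>

lemma riesz_representation:
  fixes \<phi> :: "'a::{real_inner, complete_space} \<Rightarrow>\<^sub>L real"
  assumes V: "subspace V" "closed V"
  obtains r where "r \<in> V" "\<And>v. v \<in> V \<Longrightarrow> inner r v = \<phi> v"
proof -
  define J where "J v = (norm v)\<^sup>2 - 2 * \<phi> v" for v
  define d where "d = Inf (J ` V)"
  have J_ge: "- (norm \<phi>)\<^sup>2 \<le> J v" for v
  proof -
    have "\<phi> v \<le> norm \<phi> * norm v"
      using norm_blinfun[of \<phi> v] by simp
    moreover have "0 \<le> (norm v - norm \<phi>)\<^sup>2" by simp
    ultimately show ?thesis
      unfolding J_def by (simp add: power2_diff algebra_simps)
  qed
  have bdd: "bdd_below (J ` V)"
    by (rule bdd_belowI2) (rule J_ge)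
  have d_le: "d \<le> J v" if "v \<in> V" for v
    unfolding d_def using that bdd by (intro cInf_lower) auto
  have "\<exists>v\<in>V. J v < d + inverse (Suc n)" for n :: nat
  proof -
    have "J ` V \<noteq> {}" using subspace_0[OF V(1)] by auto
    then have "\<exists>y\<in>J ` V. y < d + inverse (Suc n)"
      by (rule cInf_lessD) (simp add: d_def)
    then show ?thesis by auto
  qed
  then obtain w where w: "\<And>n. w n \<in> V" "\<And>n. J (w n) < d + inverse (Suc n)"
    by metis
  \<comment> \<open>The midpoint of \<open>x\<close> and \<open>y\<close> lies in \<open>V\<close>,
    so its energy is at least \<open>d\<close>. Hence near-minimisers are close to each other, and a
    minimising sequence is Cauchy.\<close>
  have parallelogram: "(norm (x - y))\<^sup>2 \<le> 2 * (J x - d) + 2 * (J y - d)" if "x \<in> V" "y \<in> V" for x y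
  proof -
    have "(1/2) *\<^sub>R (x + y) \<in> V"
      using that V(1) by (intro subspace_scale subspace_add)
    then have "d \<le> J ((1/2) *\<^sub>R (x + y))" by (rule d_le)
    also have "J ((1/2) *\<^sub>R (x + y)) = J x / 2 + J y / 2 - (norm (x - y))\<^sup>2 / 4"
      unfolding J_def
      by (simp add: power2_norm_eq_inner blinfun.scaleR_right blinfun.add_right
          inner_add_left inner_add_right inner_diff_left inner_diff_right inner_commute field_simps)
    finally show ?thesis by simp
  qed
  have "Cauchy w"
  proof (rule CauchyI)
    fix e :: real assume "e > 0"
    then obtain M :: nat where M: "inverse (Suc M) < e\<^sup>2 / 4"
      using reals_Archimedean[of "e\<^sup>2 / 4"] by auto
    have "norm (w m - w n) < e" if "m \<ge> M" "n \<ge> M" for m n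
    proof -
      have "J (w k) - d < e\<^sup>2 / 4" if "k \<ge> M" for k
      proof -
        have "inverse (real (Suc k)) \<le> inverse (real (Suc M))"
          using that by (intro le_imp_inverse_le) auto
        then show ?thesis using w(2)[of k] M by linarith
      qed
      from this[OF that(1)] this[OF that(2)]
      have "2 * (J (w m) - d) + 2 * (J (w n) - d) < 2 * (e\<^sup>2 / 4) + 2 * (e\<^sup>2 / 4)"
        by (intro add_strict_mono mult_strict_left_mono) auto
      also have "\<dots> = e\<^sup>2" by simp
      finally have "2 * (J (w m) - d) + 2 * (J (w n) - d) < e\<^sup>2" .
      with parallelogram[OF w(1) w(1)] have "(norm (w m - w n))\<^sup>2 < e\<^sup>2"
        by (rule le_less_trans)
      then show ?thesis
        using \<open>e > 0\<close> by (intro power_less_imp_less_base[of _ 2 e]) auto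
    qed
    then show "\<exists>M. \<forall>m\<ge>M. \<forall>n\<ge>M. norm (w m - w n) < e" by blast
  qed
  then obtain r where r: "w \<longlonglongrightarrow> r"
    using Cauchy_convergent convergentD by blast
  have rV: "r \<in> V"
    using V(2) w(1) r closed_sequentially by blast
  have "J r \<le> d"
  proof (rule LIMSEQ_le)
    show "(\<lambda>n. J (w n)) \<longlonglongrightarrow> J r"
      unfolding J_def by (intro tendsto_intros r)
    show "(\<lambda>n. d + inverse (real (Suc n))) \<longlonglongrightarrow> d"
      using tendsto_add[OF tendsto_const LIMSEQ_inverse_real_of_nat, of d] by simp
    show "\<exists>N. \<forall>n\<ge>N. J (w n) \<le> d + inverse (real (Suc n))"
      using w(2) less_imp_le by blast
  qed
  have "inner r v = \<phi> v" if v: "v \<in> V" for v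
  proof -
    \<comment> \<open>\<open>b\<close> is half the derivative of \<open>J\<close> at
      \<open>r\<close> in direction \<open>v\<close>, and \<open>t\<close> is a descent step. The
      summand 1 in its denominator covers \<open>v = 0\<close> and leaves the spare
      \<open>t\<^sup>2\<close> that forces \<open>t = 0\<close>.\<close>
    define b where "b = inner r v - \<phi> v"
    define t where "t = - b / (1 + inner v v)"
    have "r + t *\<^sub>R v \<in> V"
      using rV v V(1) by (intro subspace_add subspace_scale)
    then have "J r \<le> J (r + t *\<^sub>R v)"
      using d_le \<open>J r \<le> d\<close> by fastforce
    also have "J (r + t *\<^sub>R v) = J r + 2 * t * b + t\<^sup>2 * inner v v"
      unfolding J_def b_def power2_norm_eq_inner
      by (simp add: blinfun.scaleR_right blinfun.add_right
          inner_add_left inner_add_right inner_commute algebra_simps power2_eq_square)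
    finally have "0 \<le> 2 * t * b + t\<^sup>2 * (1 + inner v v) - t\<^sup>2"
      by (simp add: algebra_simps)
    moreover have "1 + inner v v > 0"
      by (simp add: add_pos_nonneg)
    then have tb: "t * (1 + inner v v) = - b"
      unfolding t_def by simp
    have "t\<^sup>2 * (1 + inner v v) = t * - b"
      unfolding tb[symmetric] by (simp add: power2_eq_square)
    moreover have "t * b = - t\<^sup>2 * (1 + inner v v)"
      using calculation(2) by simp
    moreover have "t\<^sup>2 * (1 + inner v v) \<ge> 0"
      by simp
    ultimately have "t\<^sup>2 \<le> 0" by linarith
    then have "t = 0" by simp
    with tb show ?thesis by (simp add: b_def)
  qed
  with rV show thesis by (rule that)
qed

section \<open>Strongly monotone Lipschitz operators\<close>

locale strongly_monotone_lipschitz =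
  fixes F :: "'a::{real_inner, complete_space} \<Rightarrow> 'a \<Rightarrow>\<^sub>L real"
    and L \<nu> :: real
  assumes L_pos: "L > 0"
    and lipschitz: "\<bar>(F u - F v) w\<bar> \<le> L * norm (u - v) * norm w"
    and \<nu>_pos: "\<nu> > 0"
    and strongly_monotone: "\<nu> * (norm (u - v))\<^sup>2 \<le> (F u - F v) (u - v)"
begin

section \<open>Existence and uniqueness of Galerkin solutions\<close>

lemma galerkin_unique:
  assumes "subspace V" "x \<in> V" "y \<in> V" "\<And>v. v \<in> V \<Longrightarrow> F x v = 0" "\<And>v. v \<in> V \<Longrightarrow> F y v = 0"
  shows "x = y"
proof -
  have "x - y \<in> V" using assms by (intro subspace_diff)
  then have "\<nu> * (norm (x - y))\<^sup>2 \<le> 0"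
    using strongly_monotone[of x y] assms by (simp add: blinfun.diff_left)
  then show ?thesis
    using \<nu>_pos by (simp add: mult_le_0_iff)
qed

text \<open>
  The step size \<open>t = \<nu> / (L\<^sup>2 + \<nu>\<^sup>2)\<close> makes \<open>u \<mapsto> u - t R (F u)\<close>, with \<open>R\<close> the Riesz map of \<open>V\<close>,
  a contraction without having to know that \<open>\<nu> \<le> L\<close> (which fails on the zero space).
\<close>

lemma galerkin_exists:
  assumes V: "subspace V" "closed V"
  shows "\<exists>x\<in>V. \<forall>v\<in>V. F x v = 0"
proof -
  have "\<exists>R. \<forall>x. R x \<in> V \<and> (\<forall>v\<in>V. inner (R x) v = F x v)"
    by (intro choice allI) (meson riesz_representation[OF V])
  then obtain R where RV: "\<And>x. R x \<in> V" and R: "\<And>x v. v \<in> V \<Longrightarrow> inner (R x) v = F x v"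
    by blast
  define M where "M = L\<^sup>2 + \<nu>\<^sup>2"
  define t where "t = \<nu> / M"
  define c where "c = sqrt (L\<^sup>2 / M)"
  have M: "M > 0" using L_pos by (simp add: M_def add_pos_nonneg)
  have t: "t > 0" using M \<nu>_pos by (simp add: t_def)
  have c: "0 \<le> c" "c < 1" "c\<^sup>2 = L\<^sup>2 / M"
    using M \<nu>_pos by (auto simp: c_def M_def)
  have contraction: "dist (x - t *\<^sub>R R x) (y - t *\<^sub>R R y) \<le> c * dist x y" if "x \<in> V" "y \<in> V" for x y
  proof -
    define z where "z = x - y"
    define d where "d = R x - R y"
    have V': "z \<in> V" "d \<in> V"
      using that RV V(1) by (auto simp: z_def d_def intro: subspace_diff)
    have inner_d: "inner d v = (F x - F y) v" if "v \<in> V" for v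
      using that by (simp add: d_def inner_diff_left R blinfun.diff_left)
    \<comment> \<open>The functional is tested with \<open>d\<close> itself, which is allowed
      because the Riesz representers lie in \<open>V\<close>.\<close>
    have "(norm d)\<^sup>2 \<le> L * norm z * norm d"
      using lipschitz[of x y d] inner_d[OF V'(2)] by (simp add: power2_norm_eq_inner z_def)
    then have "norm d \<le> L * norm z"
      using L_pos by (cases "norm d = 0") (auto simp: power2_eq_square)
    then have d2: "(norm d)\<^sup>2 \<le> L\<^sup>2 * (norm z)\<^sup>2"
      by (metis norm_ge_zero power_mono power_mult_distrib)
    have dz: "\<nu> * (norm z)\<^sup>2 \<le> inner d z"
      using strongly_monotone[of x y] inner_d[OF V'(1)] by (simp add: z_def)
    have "(norm (z - t *\<^sub>R d))\<^sup>2 = (norm z)\<^sup>2 - 2 * t * inner d z + t\<^sup>2 * (norm d)\<^sup>2"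
      unfolding power2_norm_eq_inner
      by (simp add: inner_diff_left inner_diff_right inner_commute power2_eq_square algebra_simps)
    \<comment> \<open>Enlarging \<open>L\<^sup>2\<close> to \<open>M\<close> makes the quadratic in
      \<open>t\<close> collapse: \<open>t * M = \<nu>\<close> turns the factor of
      \<open>(norm z)\<^sup>2\<close> into \<open>1 - t * \<nu>\<close>, which is
      \<open>c\<^sup>2\<close>.\<close>
    also have "\<dots> \<le> (norm z)\<^sup>2 - 2 * t * (\<nu> * (norm z)\<^sup>2) + t\<^sup>2 * (M * (norm z)\<^sup>2)"
    proof -
      have "(norm d)\<^sup>2 \<le> M * (norm z)\<^sup>2"
        using d2 by (simp add: M_def distrib_right add_increasing2)
      then show ?thesis
        using dz t by (intro add_mono diff_mono mult_left_mono) auto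
    qed
    also have "\<dots> = (c * norm z)\<^sup>2"
    proof -
      have "t * M = \<nu>" using M by (simp add: t_def)
      then have "t\<^sup>2 * M = t * \<nu>" by (simp add: power2_eq_square)
      have "L\<^sup>2 = M - \<nu>\<^sup>2" by (simp add: M_def)
      then have "c\<^sup>2 = 1 - t * \<nu>"
        unfolding c(3) t_def using M by (simp add: diff_divide_distrib power2_eq_square)
      then have "(c * norm z)\<^sup>2 = (1 - 2 * (t * \<nu>) + t\<^sup>2 * M) * (norm z)\<^sup>2"
        by (simp add: power_mult_distrib \<open>t\<^sup>2 * M = t * \<nu>\<close>)
      then show ?thesis by (simp add: algebra_simps)
    qed
    finally have "norm (z - t *\<^sub>R d) \<le> c * norm z"
      by (rule power2_le_imp_le) (simp add: c(1))
    then show ?thesis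
      by (simp add: dist_norm z_def d_def algebra_simps)
  qed
  have "\<exists>!x\<in>V. x - t *\<^sub>R R x = x"
  proof (rule Banach_fix[OF _ _ c(1,2)])
    show "complete V" using V(2) by (simp add: complete_eq_closed)
    show "V \<noteq> {}" using subspace_0[OF V(1)] by blast
    show "(\<lambda>x. x - t *\<^sub>R R x) ` V \<subseteq> V"
      using RV V(1) by (auto intro: subspace_diff subspace_scale)
  qed (rule contraction)
  then obtain x where "x \<in> V" "R x = 0" using t by auto
  then show ?thesis using R[of _ x] by auto
qed

lemma galerkin_solution:
  assumes "subspace V" "closed V"
  shows "galerkin_solution F V \<in> V" "v \<in> V \<Longrightarrow> F (galerkin_solution F V) v = 0"
proof -
  have "\<exists>!x. x \<in> V \<and> (\<forall>v\<in>V. F x v = 0)"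
    using galerkin_exists[OF assms] galerkin_unique[OF assms(1)] by blast
  from theI'[OF this]
  show "galerkin_solution F V \<in> V" "v \<in> V \<Longrightarrow> F (galerkin_solution F V) v = 0"
    unfolding galerkin_solution_def by auto
qed

lemma exact_solution_unique: "\<exists>!w. F w = 0"
proof -
  obtain x where "\<forall>v. F x v = 0"
    using galerkin_exists[of UNIV] by auto
  then have "F x = 0" by (intro blinfun_eqI) simp
  moreover have "y = x" if "F y = 0" for y
    using that \<open>F x = 0\<close> by (intro galerkin_unique[of UNIV]) auto
  ultimately show ?thesis by blast
qed

section \<open>Quasi-optimality and convergence of Galerkin solutions\<close>

text \<open>Galerkin orthogonality: both solutions are annihilated by test functions in
  \<open>V\<close>, so in the monotonicity estimate the direction \<open>w - x\<close> may be
  replaced by \<open>w - v\<close>. The larger space is a general \<open>W\<close>, so that the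
  closure of a union can take its place.\<close>

lemma cea:
  assumes V: "subspace V" "closed V" and W: "subspace W" "closed W" and "V \<subseteq> W" "v \<in> V"
  shows "norm (galerkin_solution F W - galerkin_solution F V)
       \<le> L / \<nu> * norm (galerkin_solution F W - v)"
proof -
  define w x where "w = galerkin_solution F W" and "x = galerkin_solution F V"
  have "v - x \<in> V"
    using galerkin_solution(1)[OF V] assms by (auto simp: x_def intro: subspace_diff)
  then have ortho: "(F w - F x) (v - x) = 0"
    using galerkin_solution(2)[OF V] galerkin_solution(2)[OF W] \<open>V \<subseteq> W\<close>
    by (auto simp: w_def x_def blinfun.diff_left)
  have "\<nu> * (norm (w - x))\<^sup>2 \<le> (F w - F x) (w - x)"
    by (rule strongly_monotone)
  also have "\<dots> = (F w - F x) ((w - v) + (v - x))" by simp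
  also have "\<dots> = (F w - F x) (w - v)"
    using ortho by (simp only: blinfun.add_right)
  also have "\<dots> \<le> L * norm (w - x) * norm (w - v)"
    using lipschitz[of w x "w - v"] by simp
  finally have "norm (w - x) * (\<nu> * norm (w - x)) \<le> norm (w - x) * (L * norm (w - v))"
    by (simp add: power2_eq_square mult_ac)
  then have "\<nu> * norm (w - x) \<le> L * norm (w - v)"
    using L_pos by (cases "norm (w - x) = 0") auto
  then show ?thesis
    using \<nu>_pos by (simp add: w_def x_def field_simps)
qed

text \<open>The limit solution can be approximated arbitrarily well from some \<open>V m\<close>.
  Such an approximant stays available in all later spaces, and Cea's lemma transfers its quality to
  their Galerkin solutions. The limit is not claimed to be the exact solution, since the union need
  not be dense.\<close>

lemma galerkin_solution_tendsto:
  assumes V: "\<And>n. subspace (V n)" "\<And>n. closed (V n)" "incseq V"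
  shows "(\<lambda>n. galerkin_solution F (V n)) \<longlonglongrightarrow> galerkin_solution F (closure (\<Union>n. V n))"
proof -
  define W where "W = closure (\<Union>n. V n)"
  define w where "w = galerkin_solution F W"
  have W: "subspace W" "closed W"
    unfolding W_def by (auto intro!: subspace_closure subspace_UN_incseq V)
  have V_W: "V n \<subseteq> W" for n
    using closure_subset[of "\<Union>n. V n"] unfolding W_def by blast
  have "w \<in> closure (\<Union>n. V n)"
    using galerkin_solution(1)[OF W] by (simp add: w_def W_def)
  have "(\<lambda>n. galerkin_solution F (V n)) \<longlonglongrightarrow> w"
  proof (rule LIMSEQ_I)
    fix e :: real assume "e > 0"
    \<comment> \<open>This tolerance cancels the factor \<open>L / \<nu>\<close> of Cea's
      lemma.\<close>
    then have "e * \<nu> / L > 0" using L_pos \<nu>_pos by simp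
    then obtain v where "v \<in> (\<Union>n. V n)" "dist v w < e * \<nu> / L"
      using \<open>w \<in> closure (\<Union>n. V n)\<close> unfolding closure_approachable by blast
    then obtain m where v: "v \<in> V m" "norm (w - v) < e * \<nu> / L"
      by (auto simp: dist_norm norm_minus_commute)
    have "norm (galerkin_solution F (V n) - w) < e" if "n \<ge> m" for n
    proof -
      have "v \<in> V n" using v(1) incseqD[OF V(3) that] by blast
      then have "norm (w - galerkin_solution F (V n)) \<le> L / \<nu> * norm (w - v)"
        unfolding w_def by (intro cea V W V_W)
      also have "\<dots> < L / \<nu> * (e * \<nu> / L)"
        using v(2) L_pos \<nu>_pos by (intro mult_strict_left_mono) auto
      also have "\<dots> = e" using L_pos \<nu>_pos by simp
      finally show ?thesis by (simp add: norm_minus_commute)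
    qed
    then show "\<exists>m. \<forall>n\<ge>m. norm (galerkin_solution F (V n) - w) < e" by blast
  qed
  then show ?thesis by (simp add: w_def W_def)
qed

text \<open>An a posteriori bound for the old iterate \<open>x\<close>: strong monotonicity controls
  its error by the residual, and the linearised equation expresses the residual through the
  increment \<open>y - x\<close>.\<close>

lemma ilg_step_error:
  fixes A :: "'a \<Rightarrow> 'a \<Rightarrow> 'a \<Rightarrow>\<^sub>L real"
  assumes A: "\<And>u. linear (A u)" and \<beta>: "\<beta> \<ge> 0"
    and bounded: "\<And>u v w. A u v w \<le> \<beta> * norm v * norm w"
    and V: "subspace V" "closed V" and x: "x \<in> V" and step: "ilg_step A F V x y"
  shows "norm (x - galerkin_solution F V) \<le> \<beta> / \<nu> * norm (y - x)"
proof -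
  define g where "g = galerkin_solution F V"
  have gV: "x - g \<in> V"
    using x galerkin_solution(1)[OF V] V(1) by (auto simp: g_def intro: subspace_diff)
  have "\<nu> * (norm (x - g))\<^sup>2 \<le> (F x - F g) (x - g)"
    by (rule strongly_monotone)
  also have "\<dots> = F x (x - g)"
    using galerkin_solution(2)[OF V gV] by (simp add: g_def blinfun.diff_left)
  \<comment> \<open>On \<open>V\<close> the step equation reads \<open>A x y = A x x - F x\<close>,
    so \<open>F x\<close> agrees there with \<open>A x (x - y)\<close>.\<close>
  also have "\<dots> = A x (x - y) (x - g)"
    using step gV
    by (simp add: ilg_step_def ilg_rhs_def blinfun.diff_left linear_diff[OF A])
  also have "\<dots> \<le> \<beta> * norm (x - y) * norm (x - g)"
    by (rule bounded)
  finally have "norm (x - g) * (\<nu> * norm (x - g)) \<le> norm (x - g) * (\<beta> * norm (y - x))"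
    by (simp add: power2_eq_square mult_ac norm_minus_commute)
  then have "\<nu> * norm (x - g) \<le> \<beta> * norm (y - x)"
    using \<beta> by (cases "norm (x - g) = 0") auto
  then show ?thesis
    using \<nu>_pos by (simp add: g_def field_simps)
qed

end

section \<open>Convergence of the adaptive algorithm\<close>

text \<open>Once the perturbation is small, the recursion contracts geometrically towards an
  arbitrarily small level.\<close>

lemma perturbed_contraction_tendsto_0:
  fixes e d :: "nat \<Rightarrow> real"
  assumes e: "\<And>n. 0 \<le> e n" and q: "0 \<le> q" "q < 1"
    and step: "\<And>n. e (Suc n) \<le> q * e n + d n" and d: "d \<longlonglongrightarrow> 0"
  shows "e \<longlonglongrightarrow> 0"
proof (rule LIMSEQ_I)
  fix r :: real assume "r > 0"
  \<comment> \<open>With perturbations up to this threshold, \<open>r / 2\<close> is a fixed point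
    of the worst-case recursion, because \<open>q * (r / 2) + (1 - q) * (r / 2) = r / 2\<close>. The
    excess above it decays like \<open>q ^ k\<close>.\<close>
  then have "(1 - q) * (r / 2) > 0" using q by simp
  from LIMSEQ_D[OF d this] obtain m where "\<forall>n\<ge>m. norm (d n) < (1 - q) * (r / 2)" by auto
  then have m: "d n \<le> (1 - q) * (r / 2)" if "n \<ge> m" for n
    using that by fastforce
  have bound: "e (m + k) \<le> q ^ k * e m + r / 2" for k
  proof (induction k)
    case 0
    show ?case using \<open>r > 0\<close> by simp
  next
    case (Suc k)
    have "e (m + Suc k) \<le> q * e (m + k) + d (m + k)" using step[of "m + k"] by simp
    also have "\<dots> \<le> q * (q ^ k * e m + r / 2) + (1 - q) * (r / 2)"
      using Suc q m[of "m + k"] by (intro add_mono mult_left_mono) auto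
    finally show ?case by (simp add: algebra_simps diff_divide_distrib)
  qed
  have "(\<lambda>k. q ^ k * e m) \<longlonglongrightarrow> 0"
    using q by (intro tendsto_mult_left_zero LIMSEQ_realpow_zero)
  from LIMSEQ_D[OF this, of "r / 2"] obtain k where k: "\<forall>n\<ge>k. norm (q ^ n * e m) < r / 2"
    using \<open>r > 0\<close> by auto
  have "norm (e n - 0) < r" if "n \<ge> m + k" for n
  proof -
    from that have "k \<le> n - m" by simp
    then have "q ^ (n - m) * e m < r / 2" using k abs_less_iff by fastforce
    then show ?thesis using bound[of "n - m"] that e[of n] by simp
  qed
  then show "\<exists>n0. \<forall>n\<ge>n0. norm (e n - 0) < r" by blast
qed

section \<open>Iterates and outputs of the inner loop\<close>

text \<open>A stopping index is at least 1, so the first one is a successor. Its predecessor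
  \<open>k\<close> is the index from which the last step was actually performed.\<close>

lemma ilg_output_cases:
  assumes "\<exists>n. ilg_stop lam \<eta> w n"
  obtains k where "ilg_output lam \<eta> w = w (Suc k)" "ilg_stop lam \<eta> w (Suc k)"
    "\<And>m. m \<le> k \<Longrightarrow> \<not> ilg_stop lam \<eta> w m"
proof -
  define n where "n = (LEAST n. ilg_stop lam \<eta> w n)"
  have n: "ilg_stop lam \<eta> w n"
    unfolding n_def using assms by (rule LeastI_ex)
  then have "n = Suc (n - 1)"
    by (simp add: ilg_stop_def)
  show thesis
  proof (rule that[of "n - 1"])
    show "ilg_output lam \<eta> w = w (Suc (n - 1))"
      using \<open>n = Suc (n - 1)\<close> by (simp add: ilg_output_def n_def)
    show "ilg_stop lam \<eta> w (Suc (n - 1))"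
      using n \<open>n = Suc (n - 1)\<close> by simp
    show "\<not> ilg_stop lam \<eta> w m" if "m \<le> n - 1" for m
    proof -
      have "m < n" using that \<open>n = Suc (n - 1)\<close> by linarith
      then show ?thesis unfolding n_def by (rule not_less_Least)
    qed
  qed
qed

text \<open>Every performed step lands in \<open>V N\<close>. The output is the result of at least
  one step, so its membership does not depend on the starting value and can be shown first. The
  start on the next level is such an output and stays inside by nestedness.\<close>

lemma adaptive_ilg_iterates:
  assumes run: "adaptive_ilg lam A F V \<eta> u" and V: "incseq V"
    and terminates: "\<And>N. \<exists>n. ilg_stop lam (\<eta> N) (u N) n"
  shows "(\<forall>m\<le>n. \<not> ilg_stop lam (\<eta> N) (u N) m) \<Longrightarrow> u N n \<in> V N"
    and "ilg_output lam (\<eta> N) (u N) \<in> V N"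
proof -
  have step: "ilg_step A F (V N) (u N n) (u N (Suc n))"
    if "\<forall>m\<le>n. \<not> ilg_stop lam (\<eta> N) (u N) m" for N n
    using run that by (simp add: adaptive_ilg_def)
  have out: "ilg_output lam (\<eta> N) (u N) \<in> V N" for N
  proof -
    obtain k where "ilg_output lam (\<eta> N) (u N) = u N (Suc k)"
        "\<And>m. m \<le> k \<Longrightarrow> \<not> ilg_stop lam (\<eta> N) (u N) m"
      using ilg_output_cases[OF terminates] by metis
    then show ?thesis
      using step[of k N] by (simp add: ilg_step_def)
  qed
  then show "ilg_output lam (\<eta> N) (u N) \<in> V N" .
  have start: "u N 0 \<in> V N"
  proof (cases N)
    case 0
    then show ?thesis using run by (simp add: adaptive_ilg_def)
  next
    case (Suc M)
    then have "u N 0 = ilg_output lam (\<eta> M) (u M)"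
      using run by (simp add: adaptive_ilg_def)
    then show ?thesis
      using out[of M] incseqD[OF V, of M N] Suc by auto
  qed
  show "u N n \<in> V N" if "\<forall>m\<le>n. \<not> ilg_stop lam (\<eta> N) (u N) m"
  proof (cases n)
    case 0
    then show ?thesis using start by simp
  next
    case (Suc k)
    then show ?thesis
      using step[of k N] that by (simp add: ilg_step_def)
  qed
qed

text \<open>The first conjunct makes the definite description \<open>exact_solution F\<close>
  meaningful in the second.\<close>

theorem corollary3p5:
  fixes F :: "'a::{real_inner, complete_space} \<Rightarrow> 'a \<Rightarrow>\<^sub>L real"
    and A :: "'a \<Rightarrow> 'a \<Rightarrow> 'a \<Rightarrow>\<^sub>L real"
    and V :: "nat \<Rightarrow> 'a set"
    and \<eta> :: "nat \<Rightarrow> 'a \<Rightarrow> real"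
    and u :: "nat \<Rightarrow> nat \<Rightarrow> 'a"
    and L \<nu> \<alpha> \<beta> CA1 CA2 lam q Cp :: real
  assumes L_pos: "L > 0"
    and F1: "\<And>u v w. \<bar>(F u - F v) w\<bar> \<le> L * norm (u - v) * norm w"
    and nu_pos: "\<nu> > 0"
    and F2: "\<And>u v. \<nu> * (norm (u - v))\<^sup>2 \<le> (F u - F v) (u - v)"
    and A_linear: "\<And>v. linear (A v)"
    and A_invertible: "\<And>v. bij (A v)"
    and alpha_pos: "\<alpha> > 0"
    and coercive: "\<And>u v. A u v v \<ge> \<alpha> * (norm v)\<^sup>2"
    and beta_pos: "\<beta> > 0"
    and bounded: "\<And>u v w. A u v w \<le> \<beta> * norm v * norm w"
    and V_subspace: "\<And>N. subspace (V N)"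
    and V_fin_dim: "\<And>N. \<exists>B. finite B \<and> V N = span B"
    and V_nested: "\<And>N. V N \<subseteq> V (Suc N)"
    and eta_nonneg: "\<And>N v. v \<in> V N \<Longrightarrow> \<eta> N v \<ge> 0"
    and CA1_ge: "CA1 \<ge> 1"
    and A1: "\<And>N v w. v \<in> V N \<Longrightarrow> w \<in> V N \<Longrightarrow> \<bar>\<eta> N v - \<eta> N w\<bar> \<le> CA1 * norm (v - w)"
    and CA2_ge: "CA2 \<ge> 1"
    and A2: "\<And>N. norm (exact_solution F - galerkin_solution F (V N))
                 \<le> CA2 * \<eta> N (galerkin_solution F (V N))"
    and lam_pos: "lam > 0"
    and lam_less: "lam < 1 / ((1 + \<beta> / \<nu>) * CA1)"
    and run: "adaptive_ilg lam A F V \<eta> u"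
    and terminates: "\<And>N. \<exists>n. ilg_stop lam (\<eta> N) (u N) n"
    and output_pos: "\<And>N. \<eta> N (ilg_output lam (\<eta> N) (u N)) > 0"
    and q_pos: "0 < q"
    and q_less: "q < 1"
    and Cp_pos: "Cp > 0"
    and reduction: "\<And>N. (\<eta> (Suc N) (galerkin_solution F (V (Suc N))))\<^sup>2
        \<le> q * (\<eta> N (galerkin_solution F (V N)))\<^sup>2
           + Cp * (norm (galerkin_solution F (V (Suc N)) - galerkin_solution F (V N)))\<^sup>2"
  shows "(\<exists>!w. F w = 0) \<and>
         (\<lambda>N. ilg_output lam (\<eta> N) (u N)) \<longlonglongrightarrow> exact_solution F"
proof -
  interpret strongly_monotone_lipschitz F L \<nu>
    using L_pos F1 nu_pos F2 by unfold_locales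
  have V_closed: "closed (V N)" for N
    using V_fin_dim[of N] closed_span_finite_real_inner by metis
  have V_mono: "incseq V"
    using V_nested by (rule incseq_SucI)
  define g where "g N = galerkin_solution F (V N)" for N
  define e where "e N = \<eta> N (g N)" for N
  have gV: "g N \<in> V N" for N
    unfolding g_def by (rule galerkin_solution(1)[OF V_subspace V_closed])
  have e_nonneg: "e N \<ge> 0" for N
    unfolding e_def by (rule eta_nonneg[OF gV])

  have "(\<lambda>N. (e N)\<^sup>2) \<longlonglongrightarrow> 0"
  proof (rule perturbed_contraction_tendsto_0)
    \<comment> \<open>Only the existence of a limit matters here: it makes successive differences
      vanish. That the limit is the exact solution follows later from \<open>A2\<close>.\<close>
    obtain w where w: "g \<longlonglongrightarrow> w"
      using galerkin_solution_tendsto[OF V_subspace V_closed V_mono] unfolding g_def by blast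
    then have "(\<lambda>N. Cp * (norm (g (Suc N) - g N))\<^sup>2) \<longlonglongrightarrow> Cp * (norm (w - w))\<^sup>2"
      by (intro tendsto_intros LIMSEQ_Suc)
    then show "(\<lambda>N. Cp * (norm (g (Suc N) - g N))\<^sup>2) \<longlonglongrightarrow> 0" by simp
    show "(e (Suc N))\<^sup>2 \<le> q * (e N)\<^sup>2 + Cp * (norm (g (Suc N) - g N))\<^sup>2" for N
      unfolding e_def g_def by (rule reduction)
  qed (use q_pos q_less in auto)
  from tendsto_real_sqrt[OF this] have e_lim: "e \<longlonglongrightarrow> 0"
    using e_nonneg by simp

  define c where "c = 1 + \<beta> / \<nu>"
  define U where "U N = ilg_output lam (\<eta> N) (u N)" for N
  have c: "c > 0" using beta_pos nu_pos by (simp add: c_def add_pos_pos)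
  \<comment> \<open>\<open>c * CA1\<close> is the constant whose inverse bounds the admissible
    \<open>lam\<close>. The strict inequality permits the absorption in
    \<open>U_error\<close>.\<close>
  have small: "c * lam * CA1 < 1"
    using lam_less c CA1_ge by (simp add: field_simps flip: c_def)
  have U_error: "norm (U N - g N) \<le> c * lam / (1 - c * lam * CA1) * e N" for N
  proof -
    obtain k where k: "U N = u N (Suc k)" "ilg_stop lam (\<eta> N) (u N) (Suc k)"
        "\<And>m. m \<le> k \<Longrightarrow> \<not> ilg_stop lam (\<eta> N) (u N) m"
      using ilg_output_cases[OF terminates] unfolding U_def by metis
    have uV: "u N k \<in> V N" "U N \<in> V N"
      using adaptive_ilg_iterates[OF run V_mono terminates] k(3) by (auto simp: U_def)
    have "ilg_step A F (V N) (u N k) (U N)"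
      using run k by (simp add: adaptive_ilg_def)
    then have "norm (u N k - g N) \<le> \<beta> / \<nu> * norm (U N - u N k)"
      unfolding g_def
      by (intro ilg_step_error[OF A_linear less_imp_le[OF beta_pos] bounded] V_subspace V_closed uV)
    moreover have "norm (U N - g N) \<le> norm (U N - u N k) + norm (u N k - g N)"
      using norm_triangle_ineq[of "U N - u N k" "u N k - g N"] by simp
    ultimately have "norm (U N - g N) \<le> c * norm (U N - u N k)"
      by (simp add: c_def distrib_right)
    also have "\<dots> \<le> c * (lam * \<eta> N (U N))"
      using k c by (intro mult_left_mono) (auto simp: ilg_stop_def)
    \<comment> \<open>\<open>A1\<close> moves the estimator from the output to the Galerkin
      solution. The price is a multiple of \<open>norm (U N - g N)\<close> with total factor
      \<open>c * lam * CA1\<close>, which is then absorbed on the left.\<close>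
    also have "\<dots> \<le> c * (lam * (e N + CA1 * norm (U N - g N)))"
      using A1[OF uV(2) gV] c lam_pos by (intro mult_left_mono) (auto simp: e_def)
    finally have "(1 - c * lam * CA1) * norm (U N - g N) \<le> c * lam * e N"
      by (simp add: algebra_simps)
    then show ?thesis
      using small by (simp add: field_simps)
  qed

  \<comment> \<open>Reliability turns the vanishing of the estimators into convergence of the
    Galerkin solutions to the exact one.\<close>
  have g_lim: "(\<lambda>N. g N - exact_solution F) \<longlonglongrightarrow> 0"
  proof (rule Lim_null_comparison)
    show "\<forall>\<^sub>F N in sequentially. norm (g N - exact_solution F) \<le> CA2 * e N"
      using A2 by (simp add: e_def g_def norm_minus_commute)
    show "(\<lambda>N. CA2 * e N) \<longlonglongrightarrow> 0"
      by (intro tendsto_mult_right_zero e_lim)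
  qed
  have "(\<lambda>N. U N - g N) \<longlonglongrightarrow> 0"
  proof (rule Lim_null_comparison)
    show "\<forall>\<^sub>F N in sequentially. norm (U N - g N) \<le> c * lam / (1 - c * lam * CA1) * e N"
      using U_error by simp
    show "(\<lambda>N. c * lam / (1 - c * lam * CA1) * e N) \<longlonglongrightarrow> 0"
      by (intro tendsto_mult_right_zero e_lim)
  qed
  from tendsto_add[OF this g_lim] have "(\<lambda>N. U N - exact_solution F) \<longlonglongrightarrow> 0"
    by simp
  then have "(\<lambda>N. ilg_output lam (\<eta> N) (u N)) \<longlonglongrightarrow> exact_solution F"
    unfolding U_def by (rule LIM_zero_cancel)
  with exact_solution_unique show ?thesis by (rule conjI)
qed

end
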